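(* Let $p$ be a prime, $n\ge 1$, $f\in\mathrm{Aut}(\mathbb{Z}_p^n)$ and let $Q=\mathrm{Aff}(\mathbb{Z}_p^n,f)$ be a connected quandle. The following are equivalent: (i) $Q$ is a non-simple subdirectly irreducible locally strictly simple quandle. (ii) $Q\cong \mathbb{Z}_p[t]/(g^2)$ as a $\mathbb{Z}_p[t]$-module, where $g$ is an irreducible polynomial over $\mathbb{Z}_p$. Moreover, in this case $Q$ is generated as a quandle by two elements and $n$ is even.
   Context: A quandle is a set $Q$ with a binary operation $*$ such that every left translation $L_a:b\mapsto a*b$ is a bijection, $a*(b*c)=(a*b)*(a*c)$ and $a*a=a$. $Q$ is connected if the group generated by all $L_a$ is transitive on $Q$. Congruences are equivalence relations compatible with $*$ and left division; $0_Q$ is equality, $1_Q=Q\times Q$. $Q$ is simple if it has no congruences besides $0_Q,1_Q$; it is subdirectly irreducible if the intersection of all congruences different from $0_Q$ is different from $0_Q$. A subquandle is proper if it has more than one element and is not all of $Q$. A quandle (with more than one element) is strictly simple if it has no proper subquandles, and locally strictly simple (LSS) if all its proper subquandles are strictly simple. For an abelian group $A$ and $f\in\mathrm{Aut}(A)$, $\mathrm{Aff}(A,f)$ is the quandle on $A$ with $a*b=a+f(b-a)$; $\mathrm{Aff}(\mathbb{Z}_p^n,f)$ is regarded as the $\mathbb{Z}_p[t]$-module $\mathbb{Z}_p^n$ with $t$ acting as $f$. *)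

theory Defs
  imports
    "HOL-Analysis.Cartesian_Space"
    "HOL-Algebra.Bij"
    "HOL-Algebra.Generated_Groups"
    "Berlekamp_Zassenhaus.Finite_Field"
begin

section \<open>Quandles on a carrier set\<close>

definition quandle :: "'a set \<Rightarrow> ('a \<Rightarrow> 'a \<Rightarrow> 'a) \<Rightarrow> bool" where
  "quandle Q m \<longleftrightarrow>
     (\<forall>a\<in>Q. bij_betw (m a) Q Q) \<and>
     (\<forall>a\<in>Q. \<forall>b\<in>Q. \<forall>c\<in>Q. m a (m b c) = m (m a b) (m a c)) \<and>
     (\<forall>a\<in>Q. m a a = a)"

definition ldiv :: "'a set \<Rightarrow> ('a \<Rightarrow> 'a \<Rightarrow> 'a) \<Rightarrow> 'a \<Rightarrow> 'a \<Rightarrow> 'a" where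
  "ldiv Q m a b = inv_into Q (m a) b"

text \<open>Elements of \<^term>\<open>BijGroup Q\<close> are extensional functions, so the left translations
  are restricted to \<open>Q\<close>.\<close>

definition left_mult_group :: "'a set \<Rightarrow> ('a \<Rightarrow> 'a \<Rightarrow> 'a) \<Rightarrow> ('a \<Rightarrow> 'a) set" where
  "left_mult_group Q m = generate (BijGroup Q) ((\<lambda>a. restrict (m a) Q) ` Q)"

definition connected_quandle :: "'a set \<Rightarrow> ('a \<Rightarrow> 'a \<Rightarrow> 'a) \<Rightarrow> bool" where
  "connected_quandle Q m \<longleftrightarrow>
     quandle Q m \<and> (\<forall>x\<in>Q. \<forall>y\<in>Q. \<exists>h\<in>left_mult_group Q m. h x = y)"

definition quandle_congruence ::
  "'a set \<Rightarrow> ('a \<Rightarrow> 'a \<Rightarrow> 'a) \<Rightarrow> ('a \<times> 'a) set \<Rightarrow> bool" where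
  "quandle_congruence Q m r \<longleftrightarrow>
     equiv Q r \<and>
     (\<forall>a a' b b'. (a, a') \<in> r \<longrightarrow> (b, b') \<in> r \<longrightarrow>
        (m a b, m a' b') \<in> r \<and> (ldiv Q m a b, ldiv Q m a' b') \<in> r)"

definition simple_quandle :: "'a set \<Rightarrow> ('a \<Rightarrow> 'a \<Rightarrow> 'a) \<Rightarrow> bool" where
  "simple_quandle Q m \<longleftrightarrow>
     quandle Q m \<and> (\<forall>r. quandle_congruence Q m r \<longrightarrow> r = Id_on Q \<or> r = Q \<times> Q)"

text \<open>The intersection of an empty family of congruences is read as \<open>Q \<times> Q\<close>.\<close>

definition subdirectly_irreducible_quandle :: "'a set \<Rightarrow> ('a \<Rightarrow> 'a \<Rightarrow> 'a) \<Rightarrow> bool" where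
  "subdirectly_irreducible_quandle Q m \<longleftrightarrow>
     quandle Q m \<and>
     (Q \<times> Q) \<inter> \<Inter>{r. quandle_congruence Q m r \<and> r \<noteq> Id_on Q} \<noteq> Id_on Q"

definition subquandle :: "'a set \<Rightarrow> 'a set \<Rightarrow> ('a \<Rightarrow> 'a \<Rightarrow> 'a) \<Rightarrow> bool" where
  "subquandle S Q m \<longleftrightarrow>
     S \<subseteq> Q \<and> (\<forall>a\<in>S. \<forall>b\<in>S. m a b \<in> S \<and> ldiv Q m a b \<in> S)"

definition proper_subquandle :: "'a set \<Rightarrow> 'a set \<Rightarrow> ('a \<Rightarrow> 'a \<Rightarrow> 'a) \<Rightarrow> bool" where
  "proper_subquandle S Q m \<longleftrightarrow> subquandle S Q m \<and> (\<exists>x\<in>S. \<exists>y\<in>S. x \<noteq> y) \<and> S \<noteq> Q"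

definition strictly_simple_quandle :: "'a set \<Rightarrow> ('a \<Rightarrow> 'a \<Rightarrow> 'a) \<Rightarrow> bool" where
  "strictly_simple_quandle Q m \<longleftrightarrow>
     quandle Q m \<and> (\<exists>x\<in>Q. \<exists>y\<in>Q. x \<noteq> y) \<and> (\<nexists>S. proper_subquandle S Q m)"

definition locally_strictly_simple_quandle :: "'a set \<Rightarrow> ('a \<Rightarrow> 'a \<Rightarrow> 'a) \<Rightarrow> bool" where
  "locally_strictly_simple_quandle Q m \<longleftrightarrow>
     quandle Q m \<and> (\<exists>x\<in>Q. \<exists>y\<in>Q. x \<noteq> y) \<and>
     (\<forall>S. proper_subquandle S Q m \<longrightarrow> strictly_simple_quandle S m)"

definition generated_subquandle :: "'a set \<Rightarrow> ('a \<Rightarrow> 'a \<Rightarrow> 'a) \<Rightarrow> 'a set \<Rightarrow> 'a set" where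
  "generated_subquandle Q m X = \<Inter>{S. subquandle S Q m \<and> X \<subseteq> S}"


section \<open>Affine quandles\<close>

definition group_automorphism :: "('a::ab_group_add \<Rightarrow> 'a) \<Rightarrow> bool" where
  "group_automorphism f \<longleftrightarrow> additive f \<and> bij f"

definition aff :: "('a::ab_group_add \<Rightarrow> 'a) \<Rightarrow> 'a \<Rightarrow> 'a \<Rightarrow> 'a" where
  "aff f a b = a + f (b - a)"

lemma quandle_aff:
  assumes "group_automorphism f"
  shows "quandle UNIV (aff f)"
proof -
  interpret additive f using assms by (simp add: group_automorphism_def)
  have b: "bij f" using assms by (simp add: group_automorphism_def)
  have "bij (aff f a)" for a
  proof -
    have "aff f a = (\<lambda>x. a + x) \<circ> f \<circ> (\<lambda>x. x - a)" by (auto simp: aff_def)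
    moreover have "bij (\<lambda>x. x - a)" by (rule bij_betw_byWitness[where f' = "\<lambda>x. x + a"]) auto
    ultimately show ?thesis using b by (simp add: bij_comp)
  qed
  then show ?thesis
    by (auto simp: quandle_def aff_def diff add zero algebra_simps)
qed


section \<open>The polynomial module structures\<close>

text \<open>\<open>poly_act f h v\<close> is \<open>h \<cdot> v\<close> in the module in which the indeterminate acts as \<open>f\<close>.\<close>

definition poly_act ::
  "('a::comm_ring_1 ^ 'n \<Rightarrow> 'a ^ 'n) \<Rightarrow> 'a poly \<Rightarrow> 'a ^ 'n \<Rightarrow> 'a ^ 'n" where
  "poly_act f h v = (\<Sum>i\<le>degree h. coeff h i *s (f ^^ i) v)"

definition poly_cong :: "'a::comm_ring_1 poly \<Rightarrow> ('a poly \<times> 'a poly) set" where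
  "poly_cong q = {(a, b). q dvd a - b}"

definition quot_carrier :: "'a::comm_ring_1 poly \<Rightarrow> 'a poly set set" where
  "quot_carrier q = UNIV // poly_cong q"

definition quot_add :: "'a::comm_ring_1 poly \<Rightarrow> 'a poly set \<Rightarrow> 'a poly set \<Rightarrow> 'a poly set" where
  "quot_add q X Y = (\<Union>a\<in>X. \<Union>b\<in>Y. poly_cong q `` {a + b})"

definition quot_smult :: "'a::comm_ring_1 poly \<Rightarrow> 'a poly \<Rightarrow> 'a poly set \<Rightarrow> 'a poly set" where
  "quot_smult q h X = (\<Union>a\<in>X. poly_cong q `` {h * a})"

lemma equiv_poly_cong: "equiv UNIV (poly_cong q)"
proof (rule equivI)
  show "refl (poly_cong q)" by (simp add: refl_on_def poly_cong_def)
  show "sym (poly_cong q)"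
    unfolding sym_def poly_cong_def by (metis (mono_tags, lifting) case_prod_conv
      dvd_minus_iff mem_Collect_eq minus_diff_eq)
  show "trans (poly_cong q)"
  proof (rule transI)
    fix a b c assume "(a, b) \<in> poly_cong q" "(b, c) \<in> poly_cong q"
    then have "q dvd (a - b) + (b - c)" unfolding poly_cong_def by (blast intro: dvd_add)
    then show "(a, c) \<in> poly_cong q" by (simp add: poly_cong_def)
  qed
qed auto

lemma quot_add_class:
  "quot_add q (poly_cong q `` {a}) (poly_cong q `` {b}) = poly_cong q `` {a + b}"
proof -
  have "congruent2 (poly_cong q) (poly_cong q) (\<lambda>a b. poly_cong q `` {a + b})"
  proof (rule congruent2I')
    fix a a' b b' assume "(a, a') \<in> poly_cong q" "(b, b') \<in> poly_cong q"
    then have "q dvd (a - a') + (b - b')" unfolding poly_cong_def by (blast intro: dvd_add)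
    then have "(a + b, a' + b') \<in> poly_cong q" by (simp add: poly_cong_def algebra_simps)
    then show "poly_cong q `` {a + b} = poly_cong q `` {a' + b'}"
      by (rule equiv_class_eq[OF equiv_poly_cong])
  qed
  then show ?thesis
    unfolding quot_add_def
    by (rule UN_equiv_class2[OF equiv_poly_cong equiv_poly_cong]) auto
qed

lemma quot_smult_class: "quot_smult q h (poly_cong q `` {a}) = poly_cong q `` {h * a}"
proof -
  have "congruent (poly_cong q) (\<lambda>a. poly_cong q `` {h * a})"
  proof (rule congruentI)
    fix a a' assume "(a, a') \<in> poly_cong q"
    then have "(h * a, h * a') \<in> poly_cong q"
      by (simp add: poly_cong_def dvd_mult flip: right_diff_distrib)
    then show "poly_cong q `` {h * a} = poly_cong q `` {h * a'}"
      by (rule equiv_class_eq[OF equiv_poly_cong])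
  qed
  then show ?thesis
    unfolding quot_smult_def by (rule UN_equiv_class[OF equiv_poly_cong]) auto
qed

text \<open>\<open>iso_poly_quot f q\<close>: the module on \<open>'a ^ 'n\<close> given by \<open>f\<close> is isomorphic, as a module
  over the polynomial ring, to the quotient by the ideal generated by \<open>q\<close>.\<close>

definition iso_poly_quot ::
  "('a::comm_ring_1 ^ 'n \<Rightarrow> 'a ^ 'n) \<Rightarrow> 'a poly \<Rightarrow> bool" where
  "iso_poly_quot f q \<longleftrightarrow>
     (\<exists>\<phi>. bij_betw \<phi> UNIV (quot_carrier q) \<and>
          (\<forall>v w. \<phi> (v + w) = quot_add q (\<phi> v) (\<phi> w)) \<and>
          (\<forall>h v. \<phi> (poly_act f h v) = quot_smult q h (\<phi> v)))"

end

theory Submission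
  imports Defs
begin

text \<open>
  The proof translates the quandle conditions into a statement about submodules and then reads it
  off from the divisors of a polynomial.

  Connectedness of \<open>Aff(A, f)\<close> for finite \<open>A\<close> forces \<open>1 - f\<close> to be bijective
  (\<open>bij_one_minus_f\<close>). Together with finiteness this makes every subquandle containing \<open>0\<close> an
  \<open>f\<close>-invariant subgroup (\<open>subquandle_iff_invariant\<close>), and every congruence the partition into the
  cosets of such a subgroup (\<open>congruence_is_coset_relation\<close>). Hence simplicity, subdirect
  irreducibility and local strict simplicity are conditions on the lattice of invariant subgroups, and
  the conjunction in question says that this lattice is a chain \<open>{0} \<subset> M \<subset> A\<close> with exactly three
  members (\<open>three_invariant_subgroups_iff\<close>).

  Over the prime field the invariant subgroups are the submodules for the polynomial ring. A module
  with exactly three submodules is generated by any vector outside \<open>M\<close>, so it is the quotient by an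
  ideal \<open>(q)\<close>. Its submodules correspond to the divisors of \<open>q\<close> up to units
  (\<open>submodule_eq_multiples\<close>, \<open>multiples_eq_iff\<close>), and \<open>q\<close> has exactly three of these precisely if it is
  associated to the square of an irreducible \<open>g\<close> (\<open>cyclic_of_three_submodules\<close>,
  \<open>three_submodules_of_cyclic\<close>).

  In that case \<open>0\<close> and any vector outside \<open>M\<close> generate the quandle. Multiplication by \<open>g\<close> has \<open>M\<close> both as
  kernel and as image, so \<open>p^n\<close> is the square of the order of \<open>M\<close> (\<open>card_eq_square_multiples\<close>), and \<open>n\<close>
  is even.
\<close>

section \<open>Subquandles and congruences of connected affine quandles\<close>

locale connected_affine =
  fixes f :: "'a::{finite,ab_group_add} \<Rightarrow> 'a"
  assumes automorphism: "group_automorphism f"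
    and connected: "connected_quandle UNIV (aff f)"
begin

sublocale additive f
  using automorphism by (simp add: group_automorphism_def)

lemma bij_f: "bij f"
  using automorphism by (simp add: group_automorphism_def)

lemma inj_f: "inj f"
  using bij_f by (rule bij_is_inj)

abbreviation finv :: "'a \<Rightarrow> 'a" where
  "finv \<equiv> inv_into UNIV f"

lemma f_finv [simp]: "f (finv x) = x"
  using bij_f by (simp add: bij_is_surj surj_f_inv_f)

lemma bij_aff: "bij (aff f a)"
  using quandle_aff[OF automorphism] by (simp add: quandle_def)

lemma ldiv_aff: "ldiv UNIV (aff f) a b = a + finv (b - a)"
  unfolding ldiv_def
  by (rule inv_f_eq) (auto simp: bij_is_inj[OF bij_aff] aff_def)

text \<open>
  Closure under negation and under the inverse of \<open>f\<close> follows from finiteness, so these are exactly the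
  \<open>f\<close>-invariant subgroups.
\<close>
definition invariant :: "'a set \<Rightarrow> bool" where
  "invariant W \<longleftrightarrow> 0 \<in> W \<and> (\<forall>x\<in>W. \<forall>y\<in>W. x + y \<in> W) \<and> (\<forall>x\<in>W. f x \<in> W)"

lemma invariant_zero: "invariant W \<Longrightarrow> 0 \<in> W"
  and invariant_add: "invariant W \<Longrightarrow> x \<in> W \<Longrightarrow> y \<in> W \<Longrightarrow> x + y \<in> W"
  and invariant_f: "invariant W \<Longrightarrow> x \<in> W \<Longrightarrow> f x \<in> W"
  by (auto simp: invariant_def)

lemma invariant_uminus:
  assumes "invariant W" "x \<in> W"
  shows "- x \<in> W"
proof -
  have "(+) x ` W = W"
    by (rule endo_inj_surj) (use assms in \<open>auto intro: invariant_add simp: inj_on_def\<close>)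
  then obtain y where "y \<in> W" "0 = x + y"
    using invariant_zero[OF assms(1)] by (metis imageE)
  then show ?thesis
    by (metis add_eq_0_iff)
qed

lemma invariant_diff: "invariant W \<Longrightarrow> x \<in> W \<Longrightarrow> y \<in> W \<Longrightarrow> x - y \<in> W"
  using invariant_add[of W x "- y"] invariant_uminus by simp

lemma invariant_finv:
  assumes "invariant W" "x \<in> W"
  shows "finv x \<in> W"
proof -
  have "f ` W = W"
    by (rule endo_inj_surj) (use assms in \<open>auto intro: invariant_f inj_on_subset[OF inj_f]\<close>)
  then obtain y where "y \<in> W" "x = f y"
    using assms(2) by auto
  then show ?thesis
    by (simp add: inj_f)
qed

lemma invariant_Int: "invariant U \<Longrightarrow> invariant W \<Longrightarrow> invariant (U \<inter> W)"
  by (simp add: invariant_def)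

text \<open>
  A left translation moves every point \<open>x\<close> by an element of the range of \<open>1 - f\<close>, and so does every
  composition of left translations and their inverses.
\<close>
lemma left_mult_group_displacement:
  assumes "h \<in> left_mult_group UNIV (aff f)"
  shows "h \<in> Bij UNIV" and "h x - x \<in> range (\<lambda>z. z - f z)"
proof -
  let ?R = "range (\<lambda>z. z - f z)"
  have R_minus: "- y \<in> ?R" if "y \<in> ?R" for y
  proof -
    from that obtain z where "y = z - f z" by auto
    then have "- y = (- z) - f (- z)" by (simp add: minus)
    then show ?thesis by blast
  qed
  have R_add: "y + y' \<in> ?R" if "y \<in> ?R" "y' \<in> ?R" for y y'
  proof -
    from that obtain z z' where "y = z - f z" "y' = z' - f z'" by auto
    then have "y + y' = (z + z') - f (z + z')" by (simp add: add)
    then show ?thesis by blast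
  qed
  have gen: "aff f a \<in> Bij UNIV \<and> (\<forall>x. aff f a x - x \<in> ?R)" for a
  proof -
    have "aff f a x - x = (a - x) - f (a - x)" for x
      by (simp add: aff_def diff)
    then have "aff f a x - x \<in> ?R" for x by blast
    then show ?thesis
      using bij_aff by (simp add: Bij_def)
  qed
  have *: "h \<in> Bij UNIV \<and> (\<forall>x. h x - x \<in> ?R)"
    using assms unfolding left_mult_group_def
  proof (induction rule: generate.induct)
    case one
    have "0 - f 0 \<in> ?R" by blast
    then show ?case using id_Bij[of UNIV] by (auto simp: BijGroup_def Bij_def zero restrict_UNIV)
  next
    case (incl h)
    then show ?case using gen by (auto simp: restrict_UNIV)
  next
    case (inv h)
    then have h: "h \<in> Bij UNIV" "\<forall>x. h x - x \<in> ?R" using gen by (auto simp: restrict_UNIV)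
    then have s: "surj h" by (simp add: Bij_def bij_is_surj)
    have "inv_into UNIV h x - x \<in> ?R" for x
    proof -
      have "x - inv_into UNIV h x \<in> ?R"
        using h(2) surj_f_inv_f[OF s] by metis
      from R_minus[OF this] show ?thesis by (simp only: minus_diff_eq)
    qed
    moreover have "bij (inv_into UNIV h)"
      using h(1) by (simp add: Bij_def bij_imp_bij_inv)
    ultimately show ?case
      using h(1) by (simp add: inv_BijGroup Bij_def)
  next
    case (eng h1 h2)
    have "h1 (h2 x) - x \<in> ?R" for x
      using R_add[of "h1 (h2 x) - h2 x" "h2 x - x"] eng by simp
    then show ?case
      using eng compose_Bij[of h1 UNIV h2]
      by (auto simp: BijGroup_def compose_def restrict_UNIV)
  qed
  then show "h \<in> Bij UNIV" "h x - x \<in> ?R" by auto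
qed

text \<open>
  By transitivity \<open>0\<close> can be moved to every point, so \<open>1 - f\<close> is onto.
\<close>
lemma bij_one_minus_f: "bij (\<lambda>x. x - f x)"
proof -
  have "y \<in> range (\<lambda>x. x - f x)" for y
  proof -
    obtain h where "h \<in> left_mult_group UNIV (aff f)" "h 0 = y"
      using connected by (auto simp: connected_quandle_def)
    then show ?thesis using left_mult_group_displacement(2)[of h 0] by simp
  qed
  then have "surj (\<lambda>x. x - f x)" by blast
  then show ?thesis by (simp add: bij_def finite_UNIV_surj_inj)
qed

text \<open>
  For \<open>z\<close> in a subquandle \<open>S\<close> with \<open>0 \<in> S\<close> the products \<open>0 * z = f z\<close> and \<open>z * 0 = (1 - f) z\<close> lie in
  \<open>S\<close>. By finiteness and injectivity both \<open>f\<close> and \<open>1 - f\<close> permute \<open>S\<close>, so any \<open>x, y \<in> S\<close> can be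
  written as \<open>x = (1 - f) a\<close> and \<open>y = f b\<close> with \<open>a, b \<in> S\<close>, and then \<open>x + y = a * b\<close>.
\<close>
lemma subquandle_iff_invariant:
  assumes "0 \<in> S"
  shows "subquandle S UNIV (aff f) \<longleftrightarrow> invariant S"
proof
  assume S: "subquandle S UNIV (aff f)"
  then have closed: "a + f (b - a) \<in> S" if "a \<in> S" "b \<in> S" for a b
    using that by (simp add: subquandle_def aff_def)
  have f_closed: "f z \<in> S" if "z \<in> S" for z
    using closed[OF assms that] by simp
  have one_minus_f_closed: "z - f z \<in> S" if "z \<in> S" for z
    using closed[OF that assms] by (simp add: minus)
  have f_onto: "f ` S = S"
    by (rule endo_inj_surj) (auto intro: f_closed inj_on_subset[OF inj_f])
  have one_minus_f_onto: "(\<lambda>z. z - f z) ` S = S"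
    by (rule endo_inj_surj)
      (auto intro: one_minus_f_closed inj_on_subset[OF bij_is_inj[OF bij_one_minus_f]])
  have "x + y \<in> S" if "x \<in> S" "y \<in> S" for x y
  proof -
    have "x \<in> (\<lambda>z. z - f z) ` S" "y \<in> f ` S"
      using that by (simp_all only: f_onto one_minus_f_onto)
    then obtain a b where "a \<in> S" "x = a - f a" "b \<in> S" "y = f b" by blast
    then show ?thesis using closed[of a b] by (simp add: diff add_diff_eq diff_add_eq)
  qed
  then show "invariant S"
    using assms f_closed by (simp add: invariant_def)
next
  assume "invariant S"
  then show "subquandle S UNIV (aff f)"
    by (auto simp: subquandle_def aff_def ldiv_aff
        intro: invariant_add invariant_diff invariant_f invariant_finv)
qed

lemma subquandle_translate:
  assumes "subquandle S UNIV (aff f)"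
  shows "subquandle ((\<lambda>x. x - c) ` S) UNIV (aff f)"
proof -
  have "(a - c) + f ((b - c) - (a - c)) \<in> (\<lambda>x. x - c) ` S"
    and "(a - c) + finv ((b - c) - (a - c)) \<in> (\<lambda>x. x - c) ` S" if ab: "a \<in> S" "b \<in> S" for a b
  proof -
    have "a + f (b - a) \<in> S" "a + finv (b - a) \<in> S"
      using assms ab by (simp_all add: subquandle_def aff_def ldiv_aff)
    then show "(a - c) + f ((b - c) - (a - c)) \<in> (\<lambda>x. x - c) ` S"
      and "(a - c) + finv ((b - c) - (a - c)) \<in> (\<lambda>x. x - c) ` S"
      by (auto simp: image_iff algebra_simps)
  qed
  then show ?thesis
    by (simp add: subquandle_def aff_def ldiv_aff)
qed

lemma invariant_translate:
  assumes "subquandle S UNIV (aff f)" "c \<in> S"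
  shows "invariant ((\<lambda>x. x - c) ` S)"
proof -
  have "0 \<in> (\<lambda>x. x - c) ` S"
    by (rule image_eqI[OF _ assms(2)]) simp
  from subquandle_iff_invariant[OF this] subquandle_translate[OF assms(1)]
  show ?thesis by (rule iffD1)
qed

definition coset_relation :: "'a set \<Rightarrow> ('a \<times> 'a) set" where
  "coset_relation W = {(a, b). b - a \<in> W}"

lemma coset_relation_eq_Id: "coset_relation W = Id_on UNIV \<longleftrightarrow> W = {0}"
proof
  assume *: "coset_relation W = Id_on UNIV"
  have "x \<in> W \<longleftrightarrow> (0, x) \<in> coset_relation W" for x
    by (simp add: coset_relation_def)
  then show "W = {0}" by (auto simp: * Id_on_def)
qed (auto simp: coset_relation_def)

lemma coset_relation_eq_UNIV: "coset_relation W = UNIV \<times> UNIV \<longleftrightarrow> W = UNIV"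
proof
  assume *: "coset_relation W = UNIV \<times> UNIV"
  have "x \<in> W \<longleftrightarrow> (0, x) \<in> coset_relation W" for x
    by (simp add: coset_relation_def)
  then show "W = UNIV" by (auto simp: *)
qed (auto simp: coset_relation_def)

lemma congruence_coset_relation:
  assumes W: "invariant W"
  shows "quandle_congruence UNIV (aff f) (coset_relation W)"
proof -
  have "equiv UNIV (coset_relation W)"
  proof (rule equivI)
    show "refl (coset_relation W)"
      using invariant_zero[OF W] by (simp add: refl_on_def coset_relation_def)
    show "sym (coset_relation W)"
    proof (rule symI)
      fix a b assume "(a, b) \<in> coset_relation W"
      then show "(b, a) \<in> coset_relation W"
        using invariant_uminus[OF W, of "b - a"] by (simp add: coset_relation_def)
    qed
    show "trans (coset_relation W)"
    proof (rule transI)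
      fix a b c assume "(a, b) \<in> coset_relation W" "(b, c) \<in> coset_relation W"
      then show "(a, c) \<in> coset_relation W"
        using invariant_add[OF W, of "c - b" "b - a"] by (simp add: coset_relation_def)
    qed
  qed simp
  moreover have "a' + f (b' - a') - (a + f (b - a)) \<in> W"
    and "a' + finv (b' - a') - (a + finv (b - a)) \<in> W"
    if "a' - a \<in> W" "b' - b \<in> W" for a a' b b'
  proof -
    have u: "(b' - b) - (a' - a) \<in> W" by (rule invariant_diff[OF W that(2,1)])
    have "(a' - a) + f ((b' - b) - (a' - a)) \<in> W"
      using that u W by (intro invariant_add invariant_f)
    then show "a' + f (b' - a') - (a + f (b - a)) \<in> W"
      by (simp add: add diff algebra_simps)
    have finv_diff: "finv (x - y) = finv x - finv y" for x y
      by (rule inv_f_eq[OF inj_f]) (simp add: diff)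
    have finv_add: "finv (x + y) = finv x + finv y" for x y
      by (rule inv_f_eq[OF inj_f]) (simp add: add)
    have "(a' - a) + finv ((b' - b) - (a' - a)) \<in> W"
      using that u W by (intro invariant_add invariant_finv)
    then show "a' + finv (b' - a') - (a + finv (b - a)) \<in> W"
      by (simp add: finv_diff finv_add algebra_simps)
  qed
  ultimately show ?thesis
    by (simp add: quandle_congruence_def coset_relation_def ldiv_aff aff_def)
qed

text \<open>
  Translation by \<open>(1 - f) c\<close> is left translation by \<open>c\<close> after left division by \<open>0\<close>. Since \<open>1 - f\<close> is
  onto, a congruence is preserved by all translations of the group, hence is determined by the class
  of \<open>0\<close>; that class is a subquandle because \<open>0 * 0 = 0\<close>.
\<close>
lemma congruence_is_coset_relation:
  assumes r: "quandle_congruence UNIV (aff f) r"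
  obtains W where "invariant W" "r = coset_relation W"
proof -
  have equiv: "equiv UNIV r" using r by (simp add: quandle_congruence_def)
  have refl: "(a, a) \<in> r" for a using equiv by (auto simp: equiv_def refl_on_def)
  have sym: "(b, a) \<in> r" if "(a, b) \<in> r" for a b
    using equiv that by (auto simp: equiv_def sym_def)
  have trans: "(a, c) \<in> r" if "(a, b) \<in> r" "(b, c) \<in> r" for a b c
    using equiv that by (auto simp: equiv_def trans_def)
  have mult: "(aff f a b, aff f a' b') \<in> r"
    and ldiv: "(ldiv UNIV (aff f) a b, ldiv UNIV (aff f) a' b') \<in> r"
    if "(a, a') \<in> r" "(b, b') \<in> r" for a a' b b'
    using r that unfolding quandle_congruence_def by blast+
  have translate: "(a + c, b + c) \<in> r" if ab: "(a, b) \<in> r" for a b c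
  proof -
    obtain d where d: "c = d - f d" using bij_is_surj[OF bij_one_minus_f] by (metis surjD)
    have "aff f d (ldiv UNIV (aff f) 0 x) = x + c" for x
      by (simp add: aff_def ldiv_aff diff d)
    then show ?thesis using mult[OF refl ldiv[OF refl ab]] by metis
  qed
  define W where "W = {x. (0, x) \<in> r}"
  have "subquandle W UNIV (aff f)"
    unfolding subquandle_def
  proof (intro conjI ballI)
    fix a b assume "a \<in> W" "b \<in> W"
    then have "(0, a) \<in> r" "(0, b) \<in> r" by (auto simp: W_def)
    then have "(aff f 0 0, aff f a b) \<in> r"
      and "(ldiv UNIV (aff f) 0 0, ldiv UNIV (aff f) a b) \<in> r"
      by (rule mult, rule ldiv)
    moreover have "aff f 0 0 = 0" "ldiv UNIV (aff f) 0 0 = 0"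
      by (simp_all add: aff_def ldiv_aff zero inv_f_eq[OF inj_f zero])
    ultimately show "aff f a b \<in> W" "ldiv UNIV (aff f) a b \<in> W"
      by (simp_all add: W_def)
  qed simp
  moreover have "0 \<in> W" by (simp add: W_def refl)
  ultimately have "invariant W" by (simp add: subquandle_iff_invariant)
  moreover have "(a, b) \<in> r \<longleftrightarrow> b - a \<in> W" for a b
    using translate[of a b "- a"] translate[of 0 "b - a" a] by (auto simp: W_def)
  then have "r = coset_relation W" by (auto simp: coset_relation_def)
  ultimately show ?thesis using that by blast
qed

lemma simple_quandle_iff:
  "simple_quandle UNIV (aff f) \<longleftrightarrow> (\<forall>W. invariant W \<longrightarrow> W = {0} \<or> W = UNIV)"
proof
  assume simple: "simple_quandle UNIV (aff f)"
  show "\<forall>W. invariant W \<longrightarrow> W = {0} \<or> W = UNIV"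
  proof (intro allI impI)
    fix W assume "invariant W"
    then have "coset_relation W = Id_on UNIV \<or> coset_relation W = UNIV \<times> UNIV"
      using simple congruence_coset_relation unfolding simple_quandle_def by blast
    then show "W = {0} \<or> W = UNIV"
      by (simp only: coset_relation_eq_Id coset_relation_eq_UNIV)
  qed
next
  assume W: "\<forall>W. invariant W \<longrightarrow> W = {0} \<or> W = UNIV"
  have "r = Id_on UNIV \<or> r = UNIV \<times> UNIV" if r: "quandle_congruence UNIV (aff f) r" for r
  proof -
    obtain V where "invariant V" "r = coset_relation V"
      by (rule congruence_is_coset_relation[OF r])
    then show ?thesis
      using W by (simp only: coset_relation_eq_Id coset_relation_eq_UNIV)
  qed
  then show "simple_quandle UNIV (aff f)"
    by (simp add: simple_quandle_def quandle_aff[OF automorphism])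
qed

text \<open>
  The congruences other than equality correspond to the invariant subgroups other than \<open>{0}\<close>, and their
  intersection contains a pair \<open>(a, b)\<close> iff all these subgroups contain \<open>b - a\<close>.
\<close>
lemma subdirectly_irreducible_iff:
  "subdirectly_irreducible_quandle UNIV (aff f) \<longleftrightarrow>
     (\<exists>x. x \<noteq> 0 \<and> (\<forall>W. invariant W \<longrightarrow> W \<noteq> {0} \<longrightarrow> x \<in> W))"
proof -
  define C where "C = {r. quandle_congruence UNIV (aff f) r \<and> r \<noteq> Id_on UNIV}"
  have mem: "(a, b) \<in> \<Inter>C \<longleftrightarrow> (\<forall>W. invariant W \<longrightarrow> W \<noteq> {0} \<longrightarrow> b - a \<in> W)" for a b
  proof
    assume ab: "(a, b) \<in> \<Inter>C"
    show "\<forall>W. invariant W \<longrightarrow> W \<noteq> {0} \<longrightarrow> b - a \<in> W"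
    proof (intro allI impI)
      fix W assume W: "invariant W" "W \<noteq> {0}"
      then have "coset_relation W \<in> C"
        unfolding C_def mem_Collect_eq coset_relation_eq_Id
        by (simp add: congruence_coset_relation)
      then have "(a, b) \<in> coset_relation W" using ab by blast
      then show "b - a \<in> W" by (simp add: coset_relation_def)
    qed
  next
    assume ab: "\<forall>W. invariant W \<longrightarrow> W \<noteq> {0} \<longrightarrow> b - a \<in> W"
    show "(a, b) \<in> \<Inter>C"
    proof (rule InterI)
      fix r assume "r \<in> C"
      then have r: "quandle_congruence UNIV (aff f) r" "r \<noteq> Id_on UNIV"
        unfolding C_def by blast+
      obtain W where W: "invariant W" "r = coset_relation W"
        by (rule congruence_is_coset_relation[OF r(1)])
      then have "W \<noteq> {0}" using r(2) coset_relation_eq_Id by blast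
      then have "b - a \<in> W" using ab W(1) by blast
      then show "(a, b) \<in> r" by (simp add: W(2) coset_relation_def)
    qed
  qed
  have "Id_on UNIV \<subseteq> \<Inter>C"
  proof (rule subrelI)
    fix a b :: 'a assume "(a, b) \<in> Id_on UNIV"
    then show "(a, b) \<in> \<Inter>C" unfolding mem by (auto simp: invariant_zero)
  qed
  then have "\<Inter>C \<noteq> Id_on UNIV \<longleftrightarrow> (\<exists>a b. a \<noteq> b \<and> (a, b) \<in> \<Inter>C)"
  proof (intro iffI)
    assume Id: "Id_on UNIV \<subseteq> \<Inter>C" and neq: "\<Inter>C \<noteq> Id_on UNIV"
    then obtain z where z: "z \<in> \<Inter>C" "z \<notin> Id_on UNIV" by (meson subsetI subset_antisym)
    obtain a b where ab: "z = (a, b)" by (rule prod.exhaust)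
    have "a \<noteq> b" using z(2) by (auto simp: ab)
    with z(1) show "\<exists>a b. a \<noteq> b \<and> (a, b) \<in> \<Inter>C" unfolding ab by (intro exI conjI)
  next
    assume "\<exists>a b. a \<noteq> b \<and> (a, b) \<in> \<Inter>C"
    then obtain a b where "a \<noteq> b" "(a, b) \<in> \<Inter>C" by (elim exE conjE)
    moreover have "(a, b) \<notin> Id_on UNIV" using \<open>a \<noteq> b\<close> by auto
    ultimately show "\<Inter>C \<noteq> Id_on UNIV" by (intro notI) (simp only:)
  qed
  also have "\<dots> \<longleftrightarrow> (\<exists>x. x \<noteq> 0 \<and> (\<forall>W. invariant W \<longrightarrow> W \<noteq> {0} \<longrightarrow> x \<in> W))"
  proof
    assume "\<exists>a b. a \<noteq> b \<and> (a, b) \<in> \<Inter>C"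
    then obtain a b where "a \<noteq> b" "(a, b) \<in> \<Inter>C" by (elim exE conjE)
    then show "\<exists>x. x \<noteq> 0 \<and> (\<forall>W. invariant W \<longrightarrow> W \<noteq> {0} \<longrightarrow> x \<in> W)"
      unfolding mem by (intro exI[of _ "b - a"]) simp
  next
    assume "\<exists>x. x \<noteq> 0 \<and> (\<forall>W. invariant W \<longrightarrow> W \<noteq> {0} \<longrightarrow> x \<in> W)"
    then obtain x where "x \<noteq> 0" "\<forall>W. invariant W \<longrightarrow> W \<noteq> {0} \<longrightarrow> x \<in> W" by (elim exE conjE)
    then show "\<exists>a b. a \<noteq> b \<and> (a, b) \<in> \<Inter>C"
      unfolding mem by (intro exI[of _ 0] exI[of _ x]) simp
  qed
  finally show ?thesis
    by (simp add: subdirectly_irreducible_quandle_def quandle_aff[OF automorphism] C_def)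
qed

lemma quandle_subquandle:
  assumes S: "subquandle S UNIV (aff f)"
  shows "quandle S (aff f)"
proof -
  have "bij_betw (aff f a) S S" if "a \<in> S" for a
  proof -
    have inj: "inj_on (aff f a) S" by (rule inj_on_subset[OF bij_is_inj[OF bij_aff]]) simp
    have "aff f a ` S \<subseteq> S" using S that by (auto simp: subquandle_def)
    then have "aff f a ` S = S" by (rule endo_inj_surj[OF finite _ inj])
    with inj show ?thesis by (simp add: bij_betw_def)
  qed
  moreover have "quandle UNIV (aff f)" by (rule quandle_aff[OF automorphism])
  ultimately show ?thesis by (simp add: quandle_def)
qed

text \<open>
  Left division in a subquandle is the restriction of left division in the whole quandle, although
  it is defined through the inverse of a map with a smaller domain.
\<close>
lemma subquandle_of_subquandle:
  assumes S: "subquandle S UNIV (aff f)"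
  shows "subquandle T S (aff f) \<longleftrightarrow> T \<subseteq> S \<and> subquandle T UNIV (aff f)"
proof -
  have "ldiv S (aff f) a b = ldiv UNIV (aff f) a b" if "a \<in> S" "b \<in> S" for a b
  proof -
    let ?c = "ldiv UNIV (aff f) a b"
    have "?c \<in> S" using S that by (simp add: subquandle_def)
    moreover have "aff f a ?c = b" by (simp add: ldiv_aff aff_def)
    moreover have "inj_on (aff f a) S" by (rule inj_on_subset[OF bij_is_inj[OF bij_aff]]) simp
    ultimately show ?thesis
      unfolding ldiv_def[of S] by (metis inv_into_f_f)
  qed
  then show ?thesis
    unfolding subquandle_def by (auto simp: subset_iff)
qed

text \<open>
  Subtracting an element of the smaller one turns a pair \<open>T \<subseteq> S\<close> of nested subquandles into a pair of nested
  invariant subgroups. So it suffices to consider the subquandles that contain \<open>0\<close>.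
\<close>
lemma locally_strictly_simple_iff:
  "locally_strictly_simple_quandle UNIV (aff f) \<longleftrightarrow>
     UNIV \<noteq> {0::'a} \<and>
     (\<forall>U W. invariant U \<longrightarrow> invariant W \<longrightarrow> U \<subseteq> W \<longrightarrow> W \<noteq> UNIV \<longrightarrow> U = {0} \<or> U = W)"
    (is "?LSS \<longleftrightarrow> ?nontrivial \<and> ?min")
proof -
  have nontrivial: "(\<exists>x\<in>UNIV. \<exists>y\<in>UNIV. x \<noteq> (y::'a)) \<longleftrightarrow> ?nontrivial"
  proof
    assume "\<exists>x\<in>UNIV. \<exists>y\<in>UNIV. x \<noteq> (y::'a)"
    then show ?nontrivial by (metis UNIV_I singletonD)
  next
    assume ?nontrivial
    then obtain x :: 'a where "x \<noteq> 0" by blast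
    then show "\<exists>x\<in>UNIV. \<exists>y\<in>UNIV. x \<noteq> (y::'a)" by blast
  qed
  have two_elements: "\<exists>x\<in>W. \<exists>y\<in>W. x \<noteq> y" if "invariant W" "W \<noteq> {0}" for W
  proof -
    have "0 \<in> W" by (rule invariant_zero[OF that(1)])
    moreover have "\<exists>x\<in>W. x \<noteq> 0" using that(2) \<open>0 \<in> W\<close> by auto
    ultimately show ?thesis by blast
  qed
  have inv_sub: "subquandle W UNIV (aff f)" if "invariant W" for W
    by (rule subquandle_iff_invariant[OF invariant_zero[OF that], THEN iffD2, OF that])
  show ?thesis
  proof
    assume lss: ?LSS
    have "U = {0} \<or> U = W"
      if U: "invariant U" and W: "invariant W" and UW: "U \<subseteq> W" and "W \<noteq> UNIV" for U W
    proof (rule ccontr)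
      assume contr: "\<not> (U = {0} \<or> U = W)"
      then have "W \<noteq> {0}" using UW invariant_zero[OF U] by blast
      then have "proper_subquandle W UNIV (aff f)"
        using \<open>W \<noteq> UNIV\<close> W inv_sub two_elements by (simp add: proper_subquandle_def)
      then have "strictly_simple_quandle W (aff f)"
        using lss by (simp add: locally_strictly_simple_quandle_def)
      moreover have "proper_subquandle U W (aff f)"
        using contr U UW inv_sub two_elements subquandle_of_subquandle[OF inv_sub[OF W]]
        by (simp add: proper_subquandle_def)
      ultimately show False by (auto simp: strictly_simple_quandle_def)
    qed
    then show "?nontrivial \<and> ?min"
      using lss nontrivial unfolding locally_strictly_simple_quandle_def by blast
  next
    assume min: "?nontrivial \<and> ?min"
    have "strictly_simple_quandle S (aff f)" if S: "proper_subquandle S UNIV (aff f)" for S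
    proof -
      have S_sub: "subquandle S UNIV (aff f)" and S_two: "\<exists>x\<in>S. \<exists>y\<in>S. x \<noteq> y" and "S \<noteq> UNIV"
        using S by (auto simp: proper_subquandle_def)
      have "\<not> proper_subquandle T S (aff f)" for T
      proof
        assume "proper_subquandle T S (aff f)"
        then have T: "T \<subseteq> S" "subquandle T UNIV (aff f)" "T \<noteq> S"
          and "\<exists>x\<in>T. \<exists>y\<in>T. x \<noteq> y"
          using subquandle_of_subquandle[OF S_sub] by (auto simp: proper_subquandle_def)
        then obtain c e where c: "c \<in> T" "e \<in> T" "e \<noteq> c" by blast
        let ?U = "(\<lambda>x. x - c) ` T" and ?W = "(\<lambda>x. x - c) ` S"
        have inj: "inj (\<lambda>x. x - c)" by (simp add: inj_def)
        have "invariant ?U" "invariant ?W"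
          using T(1) c(1) by (auto intro!: invariant_translate S_sub T(2))
        moreover have "?U \<subseteq> ?W" using T by auto
        moreover have "range (\<lambda>x. x - c) = UNIV"
          by (rule surjI[of _ "\<lambda>x. x + c"]) simp
        then have "?W \<noteq> UNIV"
          using \<open>S \<noteq> UNIV\<close> inj_image_eq_iff[OF inj, of S UNIV] by simp
        moreover have "e - c \<in> ?U" "e - c \<noteq> 0" using c by auto
        then have "?U \<noteq> {0}" by (metis singletonD)
        ultimately have "?U = ?W" using min by (elim conjE allE[of _ ?U] allE[of _ ?W]) simp
        then have "T = S" by (simp only: inj_image_eq_iff[OF inj])
        then show False using T(3) by simp
      qed
      then show ?thesis
        using S_sub S_two quandle_subquandle by (simp add: strictly_simple_quandle_def)
    qed
    then show ?LSS
      using min nontrivial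
      by (simp add: locally_strictly_simple_quandle_def quandle_aff[OF automorphism])
  qed
qed

text \<open>
  A non-simple quandle has an invariant subgroup \<open>M\<close> other than \<open>{0}\<close> and the whole group. If \<open>W\<close> is
  another one, then subdirect irreducibility gives \<open>W \<inter> M \<noteq> {0}\<close>, and local strict simplicity of both
  \<open>W\<close> and \<open>M\<close> gives \<open>W = W \<inter> M = M\<close>.
\<close>
lemma three_invariant_subgroups_iff:
  "\<not> simple_quandle UNIV (aff f) \<and> subdirectly_irreducible_quandle UNIV (aff f) \<and>
     locally_strictly_simple_quandle UNIV (aff f) \<longleftrightarrow>
   (\<exists>M. invariant M \<and> M \<noteq> {0} \<and> M \<noteq> UNIV \<and>
     (\<forall>W. invariant W \<longrightarrow> W = {0} \<or> W = M \<or> W = UNIV))"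
    (is "?L \<longleftrightarrow> (\<exists>M. ?three M)")
proof
  assume L: ?L
  from L have "\<not> (\<forall>W. invariant W \<longrightarrow> W = {0} \<or> W = UNIV)"
    by (simp only: simple_quandle_iff simp_thms)
  then obtain M where M: "invariant M" "M \<noteq> {0}" "M \<noteq> UNIV" by auto
  from L have "\<exists>x. x \<noteq> 0 \<and> (\<forall>W. invariant W \<longrightarrow> W \<noteq> {0} \<longrightarrow> x \<in> W)"
    by (simp only: subdirectly_irreducible_iff simp_thms)
  then obtain x where x: "x \<noteq> 0" "\<And>W. invariant W \<Longrightarrow> W \<noteq> {0} \<Longrightarrow> x \<in> W"
    by auto
  from L have "\<forall>U W. invariant U \<longrightarrow> invariant W \<longrightarrow> U \<subseteq> W \<longrightarrow> W \<noteq> UNIV \<longrightarrow> U = {0} \<or> U = W"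
    unfolding locally_strictly_simple_iff by (elim conjE) assumption
  then have min: "U = {0} \<or> U = W"
    if "invariant U" "invariant W" "U \<subseteq> W" "W \<noteq> UNIV" for U W
    using that by simp
  have "W = M" if W: "invariant W" "W \<noteq> {0}" "W \<noteq> UNIV" for W
  proof -
    have I: "invariant (W \<inter> M)" using W M by (simp add: invariant_Int)
    have "x \<in> W \<inter> M" using x(2)[OF W(1,2)] x(2)[OF M(1,2)] by simp
    then have "W \<inter> M \<noteq> {0}" using x(1) by auto
    then have "W \<inter> M = W" "W \<inter> M = M"
      using min[OF I W(1) _ W(3)] min[OF I M(1) _ M(3)] by auto
    then show ?thesis by blast
  qed
  then have "\<And>W. invariant W \<Longrightarrow> W = {0} \<or> W = M \<or> W = UNIV" by metis
  then show "\<exists>M. ?three M" using M by (intro exI[of _ M] conjI allI impI)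
next
  assume "\<exists>M. ?three M"
  then obtain M where M: "invariant M" "M \<noteq> {0}" "M \<noteq> UNIV"
    and three: "\<And>W. invariant W \<Longrightarrow> W = {0} \<or> W = M \<or> W = UNIV" by (elim exE conjE) simp
  then obtain x where x: "x \<in> M" "x \<noteq> 0" using invariant_zero[OF M(1)] by auto
  have "\<not> simple_quandle UNIV (aff f)"
    unfolding simple_quandle_iff using M by (intro notI) (drule spec[of _ M], simp)
  moreover have "subdirectly_irreducible_quandle UNIV (aff f)"
    unfolding subdirectly_irreducible_iff
  proof (intro exI conjI allI impI)
    show "x \<noteq> 0" by (rule x)
    show "x \<in> W" if "invariant W" "W \<noteq> {0}" for W
      using three[OF that(1)] that(2) x(1) by auto
  qed
  moreover have "locally_strictly_simple_quandle UNIV (aff f)"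
    unfolding locally_strictly_simple_iff
  proof (intro conjI allI impI)
    show "UNIV \<noteq> {0::'a}" using x(2) by blast
    fix U W assume UW: "invariant U" "invariant W" "U \<subseteq> W" "W \<noteq> UNIV"
    have "W = {0} \<or> W = M" using three[OF UW(2)] UW(4) by simp
    moreover have "U = {0} \<or> U = M" using three[OF UW(1)] UW(3,4) by auto
    ultimately show "U = {0} \<or> U = W" using UW(3) M(1,2) invariant_zero[OF UW(1)] by auto
  qed
  ultimately show ?L by blast
qed

text \<open>
  A subquandle that contains \<open>0\<close> and a point outside \<open>M\<close> is an invariant subgroup different from
  \<open>{0}\<close> and \<open>M\<close>.
\<close>
lemma two_generated_if_three_invariant_subgroups:
  assumes "M \<noteq> UNIV" "0 \<in> M" "\<And>W. invariant W \<Longrightarrow> W = {0} \<or> W = M \<or> W = UNIV"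
  shows "\<exists>a b. a \<noteq> b \<and> generated_subquandle UNIV (aff f) {a, b} = UNIV"
proof -
  obtain v where v: "v \<notin> M" using assms(1) by blast
  have "S = UNIV" if "subquandle S UNIV (aff f)" "{0, v} \<subseteq> S" for S
  proof -
    have "invariant S" by (rule subquandle_iff_invariant[THEN iffD1]) (use that in auto)
    then show ?thesis using assms(3)[of S] v that(2) assms(2) by auto
  qed
  then have "generated_subquandle UNIV (aff f) {0, v} = UNIV"
    by (auto simp: generated_subquandle_def)
  moreover have "0 \<noteq> v" using v assms(2) by blast
  ultimately show ?thesis by blast
qed

end

section \<open>Polynomials acting through an additive map\<close>

lemma of_nat_scale_vec:
  fixes v :: "'a::comm_ring_1 ^ 'n"
  shows "of_nat (Suc k) *s v = v + of_nat k *s v"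
  by (simp add: vec_eq_iff algebra_simps)

lemma mod_ring_of_nat: "\<exists>k. (c :: 'p::nontriv mod_ring) = of_nat k"
proof -
  have "c = of_int (to_int_mod_ring c)"
    by (simp add: of_int_of_int_mod_ring)
  moreover have "to_int_mod_ring c \<ge> 0"
    using range_to_int_mod_ring[where 'a='p] by (metis atLeastLessThan_iff rangeI)
  ultimately show ?thesis by (metis of_int_of_nat_eq zero_le_imp_eq_int)
qed

text \<open>The scalars are multiples of \<open>1\<close>, so additive maps are linear.\<close>
lemma additive_scale:
  fixes f :: "('p::nontriv mod_ring) ^ 'n \<Rightarrow> ('p mod_ring) ^ 'n"
  assumes "additive f"
  shows "f (c *s v) = c *s f v"
proof -
  interpret additive f by fact
  obtain k where "c = of_nat k" using mod_ring_of_nat by blast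
  moreover have "f (of_nat k *s v) = of_nat k *s f v"
    by (induction k) (simp_all add: of_nat_scale_vec add zero del: of_nat_Suc)
  ultimately show ?thesis by simp
qed

locale linear_action =
  fixes f :: "'a::comm_ring_1 ^ 'n \<Rightarrow> 'a ^ 'n"
  assumes f_add: "f (v + w) = f v + f w"
    and f_scale: "f (c *s v) = c *s f v"
begin

sublocale additive f
  by unfold_locales (rule f_add)

abbreviation act :: "'a poly \<Rightarrow> 'a ^ 'n \<Rightarrow> 'a ^ 'n" where
  "act \<equiv> poly_act f"

lemma act_0 [simp]: "act 0 v = 0"
  by (simp add: poly_act_def)

text \<open>
  Horner's rule: with it, properties of the action follow by induction on the polynomial, without
  reference to its degree.
\<close>
lemma act_pCons: "act (pCons c h) v = c *s v + f (act h v)"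
proof (cases "h = 0")
  case True
  then show ?thesis by (simp add: poly_act_def zero)
next
  case False
  have "act (pCons c h) v = c *s v + (\<Sum>i\<le>degree h. coeff h i *s f ((f ^^ i) v))"
    using False by (simp add: poly_act_def sum.atMost_Suc_shift del: sum.atMost_Suc)
  also have "(\<Sum>i\<le>degree h. coeff h i *s f ((f ^^ i) v)) = f (act h v)"
    by (simp add: poly_act_def sum f_scale)
  finally show ?thesis .
qed

lemma act_1 [simp]: "act 1 v = v"
  by (simp add: one_pCons act_pCons zero)

lemma act_add_poly: "act (g + h) v = act g v + act h v"
proof (induction g h rule: poly_induct2)
  case 0
  then show ?case by simp
next
  case (pCons a g b h)
  then show ?case by (simp add: act_pCons f_add vector_sadd_rdistrib algebra_simps)
qed

lemma act_diff_poly: "act (g - h) v = act g v - act h v"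
  using act_add_poly[of "g - h" h v] by simp

lemma act_smult: "act (smult c h) v = c *s act h v"
  by (induction h) (simp_all add: act_pCons f_scale vector_add_ldistrib vector_smult_assoc)

lemma act_mult: "act (g * h) v = act g (act h v)"
  by (induction g) (simp_all add: act_pCons act_add_poly act_smult vector_smult_lzero)

lemma act_add_vec: "act h (v + w) = act h v + act h w"
  by (induction h) (simp_all add: act_pCons f_add vector_add_ldistrib algebra_simps)

lemma act_X: "act [:0, 1:] v = f v"
  by (simp add: act_pCons zero)

definition cyclic_generator :: "'a ^ 'n \<Rightarrow> 'a poly \<Rightarrow> bool" where
  "cyclic_generator v q \<longleftrightarrow> (\<forall>x. \<exists>h. x = act h v) \<and> (\<forall>h. act h v = 0 \<longleftrightarrow> q dvd h)"

lemma poly_cong_class_eq_iff: "poly_cong q `` {a} = poly_cong q `` {b} \<longleftrightarrow> q dvd a - b"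
  using eq_equiv_class_iff[OF equiv_poly_cong, of a b q] by (simp add: poly_cong_def)

text \<open>
  An isomorphism onto the quotient by \<open>(q)\<close> provides the preimage of the class of \<open>1\<close> as a generator,
  and its annihilator is \<open>(q)\<close>. Conversely, given such a generator \<open>v\<close>, the vector \<open>h \<cdot> v\<close> is sent to
  the class of \<open>h\<close>, which is the set of all \<open>k\<close> with \<open>k \<cdot> v = h \<cdot> v\<close>.
\<close>
lemma iso_poly_quot_iff: "iso_poly_quot f q \<longleftrightarrow> (\<exists>v. cyclic_generator v q)"
proof
  assume "iso_poly_quot f q"
  then obtain \<phi> where bij: "bij_betw \<phi> UNIV (quot_carrier q)"
    and scale: "\<And>h v. \<phi> (act h v) = quot_smult q h (\<phi> v)"
    unfolding iso_poly_quot_def by blast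
  have "poly_cong q `` {1} \<in> quot_carrier q"
    by (simp add: quot_carrier_def quotientI)
  then obtain v where v: "\<phi> v = poly_cong q `` {1}"
    using bij by (metis bij_betw_imp_surj_on imageE)
  have class_of: "\<phi> (act h v) = poly_cong q `` {h}" for h
    by (simp add: scale v quot_smult_class)
  have inj: "inj \<phi>" using bij by (simp add: bij_betw_def)
  have "\<exists>h. x = act h v" for x
  proof -
    have "\<phi> x \<in> quot_carrier q" using bij by (simp add: bij_betw_apply)
    then obtain h where "\<phi> x = poly_cong q `` {h}"
      unfolding quot_carrier_def by (rule quotientE)
    then have "\<phi> x = \<phi> (act h v)" by (simp add: class_of)
    then show ?thesis using inj by (auto dest: injD)
  qed
  moreover have "act h v = 0 \<longleftrightarrow> q dvd h" for h
  proof -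
    have "act h v = 0 \<longleftrightarrow> \<phi> (act h v) = \<phi> (act 0 v)"
      using inj_eq[OF inj, of "act h v" "act 0 v"] by simp
    also have "\<dots> \<longleftrightarrow> q dvd h" by (simp only: class_of poly_cong_class_eq_iff diff_zero)
    finally show ?thesis .
  qed
  ultimately show "\<exists>v. cyclic_generator v q" by (auto simp: cyclic_generator_def)
next
  assume "\<exists>v. cyclic_generator v q"
  then obtain v where gen: "\<And>x. \<exists>h. x = act h v" and ann: "\<And>h. act h v = 0 \<longleftrightarrow> q dvd h"
    unfolding cyclic_generator_def by blast
  define \<phi> where "\<phi> x = {h. act h v = x}" for x
  have eq_iff: "act g v = act h v \<longleftrightarrow> q dvd g - h" for g h
    using ann[of "g - h"] by (simp add: act_diff_poly)
  have class_of: "\<phi> (act h v) = poly_cong q `` {h}" for h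
    by (auto simp: \<phi>_def poly_cong_def eq_iff[symmetric])
  have "inj \<phi>"
  proof (rule injI)
    fix x y assume eq: "\<phi> x = \<phi> y"
    obtain h where "x = act h v" using gen by blast
    then have "h \<in> \<phi> x" by (simp add: \<phi>_def)
    then have "h \<in> \<phi> y" by (simp add: eq)
    with \<open>h \<in> \<phi> x\<close> show "x = y" by (simp add: \<phi>_def)
  qed
  moreover have "range \<phi> = quot_carrier q"
  proof (rule Set.set_eqI)
    fix X
    have "X \<in> range \<phi> \<longleftrightarrow> (\<exists>h. X = \<phi> (act h v))" using gen by (metis rangeE rangeI)
    also have "\<dots> \<longleftrightarrow> X \<in> quot_carrier q"
      unfolding class_of quot_carrier_def quotient_def by blast
    finally show "X \<in> range \<phi> \<longleftrightarrow> X \<in> quot_carrier q" .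
  qed
  ultimately have "bij_betw \<phi> UNIV (quot_carrier q)" by (simp add: bij_betw_def)
  moreover have "\<phi> (x + y) = quot_add q (\<phi> x) (\<phi> y)" for x y
  proof -
    obtain g h where "x = act g v" "y = act h v" using gen by metis
    then show ?thesis by (simp add: class_of quot_add_class flip: act_add_poly)
  qed
  moreover have "\<phi> (act h x) = quot_smult q h (\<phi> x)" for h x
  proof -
    obtain g where "x = act g v" using gen by blast
    then show ?thesis by (simp add: class_of quot_smult_class flip: act_mult)
  qed
  ultimately show "iso_poly_quot f q" unfolding iso_poly_quot_def by blast
qed

end

section \<open>Submodules of a cyclic module\<close>

lemma principal_ideal:
  fixes I :: "'a::field poly set"
  assumes zero: "0 \<in> I" and add: "\<And>g h. g \<in> I \<Longrightarrow> h \<in> I \<Longrightarrow> g + h \<in> I"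
    and mult: "\<And>g h. h \<in> I \<Longrightarrow> g * h \<in> I"
  obtains d where "I = {h. d dvd h}"
proof (cases "I = {0}")
  case True
  then show ?thesis using that[of 0] by auto
next
  case False
  then have "\<exists>d. d \<in> I \<and> d \<noteq> 0" using zero by blast
  then obtain d where d: "d \<in> I" "d \<noteq> 0" and min: "\<And>h. h \<in> I \<and> h \<noteq> 0 \<Longrightarrow> degree d \<le> degree h"
    using ex_has_least_nat[of "\<lambda>d. d \<in> I \<and> d \<noteq> 0" _ degree] by blast
  have "d dvd h" if "h \<in> I" for h
  proof -
    have "h mod d = h + (- (h div d)) * d" by (simp add: minus_div_mult_eq_mod[symmetric])
    then have "h mod d \<in> I" using add[OF that mult[OF d(1)]] by metis
    then have "h mod d = 0" using min[of "h mod d"] degree_mod_less[OF d(2), of h] by fastforce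
    then show ?thesis by (simp add: mod_eq_0_iff_dvd)
  qed
  moreover have "h \<in> I" if "d dvd h" for h
    using that mult[OF d(1)] by (auto simp: dvd_def mult.commute)
  ultimately have "I = {h. d dvd h}" by blast
  then show ?thesis by (rule that)
qed

locale field_action = linear_action f
  for f :: "'a::field ^ 'n \<Rightarrow> 'a ^ 'n"
begin

definition submodule :: "('a ^ 'n) set \<Rightarrow> bool" where
  "submodule W \<longleftrightarrow> 0 \<in> W \<and> (\<forall>x\<in>W. \<forall>y\<in>W. x + y \<in> W) \<and> (\<forall>h. \<forall>x\<in>W. act h x \<in> W)"

text \<open>The submodule generated by \<open>d \<cdot> v\<close>.\<close>
definition multiples :: "'a ^ 'n \<Rightarrow> 'a poly \<Rightarrow> ('a ^ 'n) set" where
  "multiples v d = {act (k * d) v | k. True}"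

lemma submodule_multiples: "submodule (multiples v d)"
  unfolding submodule_def
proof (intro conjI ballI allI)
  have "act (0 * d) v \<in> multiples v d" unfolding multiples_def by blast
  then show "0 \<in> multiples v d" by simp
next
  fix x y assume "x \<in> multiples v d" "y \<in> multiples v d"
  then obtain k l where "x = act (k * d) v" "y = act (l * d) v"
    unfolding multiples_def by blast
  then have "x + y = act ((k + l) * d) v" by (simp add: act_add_poly algebra_simps)
  then show "x + y \<in> multiples v d" unfolding multiples_def by blast
next
  fix h x assume "x \<in> multiples v d"
  then obtain k where "x = act (k * d) v" unfolding multiples_def by blast
  then have "act h x = act ((h * k) * d) v" by (simp add: act_mult)
  then show "act h x \<in> multiples v d" unfolding multiples_def by blast
qed

lemma ideal_of_submodule:
  assumes "submodule W"
  obtains d where "\<And>h. act h v \<in> W \<longleftrightarrow> d dvd h"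
proof -
  have "\<exists>d. {h. act h v \<in> W} = {h. d dvd h}"
    by (rule principal_ideal[of "{h. act h v \<in> W}"])
      (use assms in \<open>auto simp: submodule_def act_add_poly act_mult\<close>)
  then show ?thesis using that by blast
qed

context
  fixes v q
  assumes v: "cyclic_generator v q"
begin

lemma generates: obtains h where "x = act h v"
  using v unfolding cyclic_generator_def by blast

lemma annihilates_iff: "act h v = 0 \<longleftrightarrow> q dvd h"
  using v by (simp add: cyclic_generator_def)

lemma act_mem_multiples_iff:
  assumes "d dvd q"
  shows "act h v \<in> multiples v d \<longleftrightarrow> d dvd h"
proof
  assume "act h v \<in> multiples v d"
  then obtain k where "act h v = act (k * d) v" unfolding multiples_def by blast
  then have "act (h - k * d) v = 0" by (simp add: act_diff_poly)
  then have "d dvd h - k * d" using assms dvd_trans by (auto simp: annihilates_iff)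
  then have "d dvd (h - k * d) + k * d" by (rule dvd_add) simp
  then show "d dvd h" by simp
next
  assume "d dvd h"
  then show "act h v \<in> multiples v d"
    unfolding multiples_def by (auto elim!: dvdE simp: mult.commute)
qed

text \<open>
  The submodules correspond to the ideals that contain \<open>q\<close>, hence to the divisors of \<open>q\<close> up to
  units.
\<close>
lemma submodule_eq_multiples:
  assumes "submodule W"
  obtains d where "d dvd q" "W = multiples v d"
proof -
  obtain d where d: "\<And>h. act h v \<in> W \<longleftrightarrow> d dvd h"
    using ideal_of_submodule[OF assms] by blast
  have "act q v \<in> W" using assms annihilates_iff[of q] by (simp add: submodule_def)
  then have "d dvd q" by (simp add: d)
  moreover have "x \<in> W \<longleftrightarrow> x \<in> multiples v d" for x
    using generates[of x] d act_mem_multiples_iff[OF \<open>d dvd q\<close>] by metis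
  ultimately show ?thesis using that by blast
qed

lemma multiples_eq_iff:
  assumes "d dvd q" "e dvd q"
  shows "multiples v d = multiples v e \<longleftrightarrow> d dvd e \<and> e dvd d"
proof
  assume "multiples v d = multiples v e"
  then have "\<And>h. d dvd h \<longleftrightarrow> e dvd h"
    using act_mem_multiples_iff assms by metis
  then show "d dvd e \<and> e dvd d" using dvd_refl by metis
next
  assume "d dvd e \<and> e dvd d"
  then have "act h v \<in> multiples v d \<longleftrightarrow> act h v \<in> multiples v e" for h
    unfolding act_mem_multiples_iff[OF assms(1)] act_mem_multiples_iff[OF assms(2)]
    using dvd_trans by metis
  then show "multiples v d = multiples v e" using generates by (metis subsetI subset_antisym)
qed

lemma multiples_eq_UNIV_iff:
  assumes "d dvd q"
  shows "multiples v d = UNIV \<longleftrightarrow> is_unit d"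
proof -
  have "x \<in> multiples v 1" for x
    using generates[of x] act_mem_multiples_iff[of 1] by (metis one_dvd)
  then have "multiples v 1 = UNIV" by blast
  then show ?thesis using multiples_eq_iff[OF assms, of 1] by simp
qed

lemma multiples_eq_zero_iff:
  assumes "d dvd q"
  shows "multiples v d = {0} \<longleftrightarrow> q dvd d"
proof -
  have "x \<in> multiples v q \<longleftrightarrow> x = 0" for x
    using generates[of x] act_mem_multiples_iff[of q] annihilates_iff by (metis dvd_refl)
  then have "multiples v q = {0}" by blast
  then show ?thesis using multiples_eq_iff[OF assms, of q] assms by simp
qed

end

text \<open>
  A vector outside \<open>M\<close> generates a submodule that is neither \<open>{0}\<close> nor \<open>M\<close>, so the module is cyclic,
  with annihilator \<open>(q)\<close> say, and \<open>M\<close> belongs to a divisor \<open>g\<close> of \<open>q\<close>. As there are no other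
  submodules, every divisor of \<open>q\<close> is a unit or associated to \<open>g\<close> or to \<open>q\<close>. This forces \<open>g\<close> to be
  irreducible, and then the cofactor of \<open>g\<close> in \<open>q\<close> to be associated to \<open>g\<close>.
\<close>
lemma cyclic_of_three_submodules:
  assumes M: "submodule M" "M \<noteq> {0}" "M \<noteq> UNIV"
    and three: "\<And>W. submodule W \<Longrightarrow> W = {0} \<or> W = M \<or> W = UNIV"
  shows "\<exists>g v. irreducible g \<and> cyclic_generator v (g\<^sup>2)"
proof -
  obtain v where vM: "v \<notin> M" using M(3) by blast
  have v_in: "v \<in> multiples v 1"
    unfolding multiples_def using act_1 by (metis (mono_tags, lifting) mem_Collect_eq mult_1_right)
  have "0 \<in> M" using M(1) by (simp add: submodule_def)
  then have "v \<noteq> 0" using vM by metis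
  then have "multiples v 1 = UNIV"
    using three[OF submodule_multiples[of v 1]] vM v_in by auto
  then have "x \<in> multiples v 1" for x by simp
  then have gen: "\<exists>h. x = act h v" for x
    unfolding multiples_def by blast
  have "submodule {0}" using submodule_multiples[of v 0] by (simp add: multiples_def)
  then obtain q where q: "\<And>h. act h v \<in> {0} \<longleftrightarrow> q dvd h"
    using ideal_of_submodule by blast
  then have v: "cyclic_generator v q" using gen by (simp add: cyclic_generator_def)
  obtain g where g: "g dvd q" "M = multiples v g"
    by (rule submodule_eq_multiples[OF v M(1)])
  have g_proper: "\<not> q dvd g" "\<not> is_unit g"
    using M(2,3) g multiples_eq_zero_iff[OF v g(1)] multiples_eq_UNIV_iff[OF v g(1)] by simp_all
  have divisors: "q dvd d \<or> d dvd g \<and> g dvd d \<or> is_unit d" if "d dvd q" for d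
    using three[OF submodule_multiples[of v d]] g(2) multiples_eq_iff[OF v that g(1)]
      multiples_eq_zero_iff[OF v that] multiples_eq_UNIV_iff[OF v that] by metis
  have "g \<noteq> 0" using g(1) g_proper(1) by auto
  have "irreducible g"
  proof (rule irreducibleI)
    fix a b assume ab: "g = a * b"
    then have "a dvd q" using g(1) by (metis dvd_mult_left)
    then consider "q dvd a" | "g dvd a" | "is_unit a" using divisors by blast
    then show "is_unit a \<or> is_unit b"
    proof cases
      case 1
      then have "q dvd g" by (simp add: ab)
      then show ?thesis using g_proper by simp
    next
      case 2
      then have "a * b dvd a * 1" using ab by simp
      then have "b dvd 1" using \<open>g \<noteq> 0\<close> ab by (metis dvd_times_left_cancel_iff mult_zero_left)
      then show ?thesis by simp
    qed simp
  qed (use \<open>g \<noteq> 0\<close> g_proper in auto)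
  obtain k where k: "q = g * k" using g(1) by (rule dvdE)
  \<comment> \<open>If \<open>q\<close> were \<open>0\<close>, the divisor \<open>g\<^sup>2\<close> would belong to a fourth submodule.\<close>
  have "q \<noteq> 0"
  proof
    assume "q = 0"
    then have "g\<^sup>2 dvd q" by simp
    then consider "q dvd g\<^sup>2" | "g\<^sup>2 dvd g" | "is_unit (g\<^sup>2)" using divisors by blast
    then show False
    proof cases
      case 2
      then have "g * g dvd g * 1" by (simp add: power2_eq_square)
      then show False using \<open>g \<noteq> 0\<close> g_proper by (metis dvd_times_left_cancel_iff)
    next
      case 1
      then show False using \<open>q = 0\<close> \<open>g \<noteq> 0\<close> by simp
    next
      case 3
      then have "g dvd 1" unfolding power2_eq_square by (rule dvd_mult_left)
      then show False using g_proper by simp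
    qed
  qed
  then have "k \<noteq> 0" using k by auto
  have "k dvd q" by (simp add: k)
  then consider "q dvd k" | "k dvd g" "g dvd k" | "is_unit k" using divisors by blast
  then have "k dvd g \<and> g dvd k"
  proof cases
    case 1
    then have "k * g dvd k * 1" by (simp add: k mult.commute)
    then have "g dvd 1" using \<open>k \<noteq> 0\<close> by (metis dvd_times_left_cancel_iff)
    then show ?thesis using g_proper by simp
  next
    case 3
    then have "q dvd g" by (simp add: k mult_unit_dvd_iff)
    then show ?thesis using g_proper by simp
  qed simp
  then have "q dvd g\<^sup>2" "g\<^sup>2 dvd q" by (simp_all add: k power2_eq_square)
  then have "g\<^sup>2 dvd h \<longleftrightarrow> q dvd h" for h using dvd_trans by metis
  then have "cyclic_generator v (g\<^sup>2)" using v by (simp add: cyclic_generator_def)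
  with \<open>irreducible g\<close> show ?thesis by blast
qed

text \<open>
  Submodules belong to divisors of \<open>g\<^sup>2\<close>, and since \<open>g\<close> is prime, such a divisor is a unit or associated
  to \<open>g\<close> or to \<open>g\<^sup>2\<close>.
\<close>
lemma three_submodules_of_cyclic:
  assumes g: "irreducible g" and v: "cyclic_generator v (g\<^sup>2)"
  shows "multiples v g \<noteq> {0}" and "multiples v g \<noteq> UNIV"
    and "\<And>W. submodule W \<Longrightarrow> W = {0} \<or> W = multiples v g \<or> W = UNIV"
proof -
  have g_proper: "g \<noteq> 0" "\<not> is_unit g" using g by (auto simp: irreducible_def)
  have g_dvd: "g dvd g\<^sup>2" by (simp add: power2_eq_square)
  have cancel: "a dvd b" if "g * a dvd g * b" for a b
    using that g_proper by simp
  have "\<not> g\<^sup>2 dvd g" using cancel[of g 1] g_proper by (auto simp: power2_eq_square)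
  then show "multiples v g \<noteq> {0}" by (simp add: multiples_eq_zero_iff[OF v g_dvd])
  show "multiples v g \<noteq> UNIV" using g_proper by (simp add: multiples_eq_UNIV_iff[OF v g_dvd])
  show "W = {0} \<or> W = multiples v g \<or> W = UNIV" if "submodule W" for W
  proof -
    obtain d where d: "d dvd g\<^sup>2" "W = multiples v d"
      by (rule submodule_eq_multiples[OF v \<open>submodule W\<close>])
    obtain e where e: "g\<^sup>2 = d * e" using d(1) by (rule dvdE)
    have split: "is_unit a \<or> is_unit b" if "g = a * b" for a b
      using g that by (rule irreducibleD)
    have "g dvd d * e" by (simp flip: e add: power2_eq_square)
    then have "g dvd d \<or> g dvd e"
      by (rule prime_elem_dvd_multD[OF field_poly_irreducible_imp_prime[OF g]])
    then have "g\<^sup>2 dvd d \<or> d dvd g \<and> g dvd d \<or> is_unit d"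
    proof
      assume "g dvd d"
      then obtain d' where d': "d = g * d'" by (rule dvdE)
      then have de: "g = d' * e" using e g_proper by (simp add: power2_eq_square mult.assoc)
      from split[OF this] show ?thesis
      proof
        assume "is_unit d'"
        then show ?thesis by (simp add: d' mult_unit_dvd_iff)
      next
        assume "is_unit e"
        then have "g dvd d'" by (simp add: de mult_unit_dvd_iff)
        then show ?thesis by (simp add: d' power2_eq_square)
      qed
    next
      assume "g dvd e"
      then obtain e' where e': "e = g * e'" by (rule dvdE)
      then have de: "g = d * e'" using e g_proper by (simp add: power2_eq_square mult.left_commute)
      from split[OF this] show ?thesis
      proof
        assume "is_unit e'"
        then have "g dvd d" by (simp add: de mult_unit_dvd_iff)
        moreover have "d dvd g" by (simp add: de)
        ultimately show ?thesis by simp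
      qed simp
    qed
    then show ?thesis
      unfolding d(2) multiples_eq_zero_iff[OF v d(1)] multiples_eq_UNIV_iff[OF v d(1)]
        multiples_eq_iff[OF v d(1) g_dvd] by blast
  qed
qed

end

section \<open>The order of the module\<close>

text \<open>Every nonempty fibre of \<open>T\<close> is a coset of the kernel.\<close>
lemma card_eq_kernel_times_image:
  fixes T :: "'b::ab_group_add \<Rightarrow> 'b"
  assumes "finite (UNIV :: 'b set)" "additive T"
  shows "CARD('b) = card {x. T x = 0} * card (range T)"
proof -
  interpret additive T by fact
  have fibre: "card {x. T x = y} = card {x. T x = 0}" if "y \<in> range T" for y
  proof -
    from that obtain x0 where x0: "y = T x0" by blast
    have "bij_betw (\<lambda>x. x + x0) {x. T x = 0} {x. T x = y}"
      by (rule bij_betw_byWitness[where f' = "\<lambda>x. x - x0"]) (auto simp: x0 add diff)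
    then show ?thesis by (simp add: bij_betw_same_card)
  qed
  have "CARD('b) = (\<Sum>y\<in>range T. card {x. T x = y})"
    using sum.group[of "UNIV :: 'b set" "range T" T "\<lambda>_. 1::nat"] assms(1) by simp
  also have "\<dots> = card {x. T x = 0} * card (range T)"
    by (simp add: fibre)
  finally show ?thesis .
qed

text \<open>
  On a module isomorphic to the quotient by \<open>(g\<^sup>2)\<close>, multiplication by \<open>g\<close> has the submodule of
  multiples of \<open>g\<close> both as its image and as its kernel.
\<close>
lemma (in field_action) card_eq_square_multiples:
  assumes fin: "finite (UNIV :: ('a ^ 'n) set)"
    and "g \<noteq> 0" and v: "cyclic_generator v (g\<^sup>2)"
  shows "CARD('a ^ 'n) = (card (multiples v g))\<^sup>2"
proof -
  have add: "additive (act g)" by (rule additive.intro) (rule act_add_vec)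
  have g_dvd: "g dvd g\<^sup>2" by (simp add: power2_eq_square)
  have "act g x = 0 \<longleftrightarrow> x \<in> multiples v g" for x
  proof -
    obtain h where x: "x = act h v" by (rule generates[OF v])
    have "act g x = 0 \<longleftrightarrow> g * g dvd g * h"
      by (simp only: x act_mult[symmetric] annihilates_iff[OF v] power2_eq_square)
    also have "\<dots> \<longleftrightarrow> x \<in> multiples v g"
      using \<open>g \<noteq> 0\<close> by (simp add: x act_mem_multiples_iff[OF v g_dvd])
    finally show ?thesis .
  qed
  then have "{x. act g x = 0} = multiples v g" by blast
  moreover have "range (act g) = multiples v g"
  proof (intro Set.set_eqI iffI)
    fix y assume "y \<in> range (act g)"
    then obtain x where y: "y = act g x" by blast
    obtain h where "x = act h v" by (rule generates[OF v])
    then have "y = act (h * g) v" by (simp add: y mult.commute flip: act_mult)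
    then show "y \<in> multiples v g" unfolding multiples_def by blast
  next
    fix y assume "y \<in> multiples v g"
    then obtain k where "y = act (k * g) v" unfolding multiples_def by blast
    then have "y = act g (act k v)" by (simp add: mult.commute flip: act_mult)
    then show "y \<in> range (act g)" by blast
  qed
  ultimately show ?thesis
    using card_eq_kernel_times_image[OF fin add] by (simp add: power2_eq_square)
qed

section \<open>The characterization\<close>

theorem proposition2p9:
  fixes f :: "('p::prime_card mod_ring) ^ 'n \<Rightarrow> ('p mod_ring) ^ 'n"
  assumes "group_automorphism f"
    and "connected_quandle UNIV (aff f)"
  shows "((\<not> simple_quandle UNIV (aff f) \<and>
           subdirectly_irreducible_quandle UNIV (aff f) \<and>
           locally_strictly_simple_quandle UNIV (aff f))
          \<longleftrightarrow> (\<exists>g :: 'p mod_ring poly. irreducible g \<and> iso_poly_quot f (g\<^sup>2))) \<and>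
         (\<not> simple_quandle UNIV (aff f) \<and>
          subdirectly_irreducible_quandle UNIV (aff f) \<and>
          locally_strictly_simple_quandle UNIV (aff f)
          \<longrightarrow> (\<exists>a b. a \<noteq> b \<and> generated_subquandle UNIV (aff f) {a, b} = UNIV) \<and>
              even CARD('n))"
    (is "(?i \<longleftrightarrow> ?ii) \<and> (?i \<longrightarrow> ?two_generated \<and> even CARD('n))")
proof -
  interpret Q: connected_affine f
    using assms by unfold_locales
  have additive: "additive f" by (rule Q.additive_axioms)
  interpret M: field_action f
    by unfold_locales (rule Q.add, rule additive_scale[OF additive])
  \<comment> \<open>Over the prime field every scalar is a multiple of \<open>1\<close>, so invariant subgroups are submodules.\<close>
  have invariant_iff: "Q.invariant W \<longleftrightarrow> M.submodule W" for W
  proof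
    assume W: "Q.invariant W"
    have scale: "c *s x \<in> W" if "x \<in> W" for c :: "'p mod_ring" and x
    proof -
      obtain k where "c = of_nat k" using mod_ring_of_nat by blast
      moreover have "of_nat k *s x \<in> W"
        by (induction k)
          (simp_all add: of_nat_scale_vec Q.invariant_zero[OF W] Q.invariant_add[OF W that]
            del: of_nat_Suc)
      ultimately show ?thesis by simp
    qed
    have "M.act h x \<in> W" if "x \<in> W" for h x
      by (induction h)
        (simp_all add: M.act_pCons scale that Q.invariant_zero[OF W] Q.invariant_add[OF W]
          Q.invariant_f[OF W])
    then show "M.submodule W" using W by (simp add: M.submodule_def Q.invariant_def)
  next
    assume W: "M.submodule W"
    then have "f x \<in> W" if "x \<in> W" for x
      using that M.act_X[of x] unfolding M.submodule_def by metis
    then show "Q.invariant W" using W by (simp add: M.submodule_def Q.invariant_def)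
  qed
  have i_iff: "?i \<longleftrightarrow> (\<exists>N. M.submodule N \<and> N \<noteq> {0} \<and> N \<noteq> UNIV \<and>
      (\<forall>W. M.submodule W \<longrightarrow> W = {0} \<or> W = N \<or> W = UNIV))"
    using Q.three_invariant_subgroups_iff by (simp only: invariant_iff)
  have ii_iff: "?ii \<longleftrightarrow> (\<exists>g v. irreducible g \<and> M.cyclic_generator v (g\<^sup>2))"
    by (simp add: M.iso_poly_quot_iff)
  have i_ii: "?i \<longleftrightarrow> ?ii"
  proof
    assume ?i
    then obtain N where "M.submodule N" "N \<noteq> {0}" "N \<noteq> UNIV"
      and "\<And>W. M.submodule W \<Longrightarrow> W = {0} \<or> W = N \<or> W = UNIV"
      unfolding i_iff by (elim exE conjE) simp
    then show ?ii unfolding ii_iff by (rule M.cyclic_of_three_submodules)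
  next
    assume ?ii
    then obtain g v where "irreducible g" "M.cyclic_generator v (g\<^sup>2)"
      unfolding ii_iff by (elim exE conjE)
    note three = M.three_submodules_of_cyclic[OF this]
    show ?i unfolding i_iff
      by (intro exI[of _ "M.multiples v g"] conjI allI impI M.submodule_multiples three)
  qed
  moreover have "?two_generated \<and> even CARD('n)" if i: ?i
  proof
    from i obtain g v where g: "irreducible g" and v: "M.cyclic_generator v (g\<^sup>2)"
      unfolding i_ii ii_iff by (elim exE conjE)
    note three = M.three_submodules_of_cyclic[OF g v]
    have "0 \<in> M.multiples v g"
      using M.submodule_multiples by (simp add: M.submodule_def)
    from Q.two_generated_if_three_invariant_subgroups[OF three(2) this, unfolded invariant_iff]
    show ?two_generated using three(3) by simp
    \<comment> \<open>\<open>p^n\<close> is the square of the order of a submodule, which is then a power of \<open>p\<close>; compare exponents.\<close>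
    have "g \<noteq> 0" using g by auto
    then have card: "CARD('p) ^ CARD('n) = (card (M.multiples v g))\<^sup>2"
      using M.card_eq_square_multiples[OF finite _ v] by simp
    then have "card (M.multiples v g) dvd CARD('p) ^ CARD('n)" by (simp add: power2_eq_square)
    then obtain k where k: "card (M.multiples v g) = CARD('p) ^ k"
      using divides_primepow_nat[OF prime_card] by blast
    have "CARD('p) ^ CARD('n) = CARD('p) ^ (2 * k)"
      using card by (simp add: k power_mult[symmetric] mult.commute)
    moreover have "CARD('p) > 1" using prime_card prime_gt_1_nat by blast
    ultimately have "CARD('n) = 2 * k" by simp
    then show "even CARD('n)" by simp
  qed
  ultimately show ?thesis by blast
qed

end
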